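(* A topological space $X$ is metrizable if and only if $X$ is strongly open-Reznichenko, closed-$\bar G_\delta$, and the topology of $X$ is generated by a (separated) uniformity possessing a $\mathfrak G$-base.
   Context: $\omega^\omega$ is the set of all functions $\omega\to\omega$ with the coordinatewise partial order. A uniformity $\mathcal U$ has a $\mathfrak G$-base if it has a base of entourages $(U_\alpha)_{\alpha\in\omega^\omega}$ with $U_\beta\subset U_\alpha$ whenever $\alpha\le\beta$ in $\omega^\omega$. All uniformities are separated, so the topologies they generate are Tychonoff (Hausdorff). $X$ is closed-$\bar G_\delta$ if for each closed $F\subset X$ there is a sequence $(W_n)_{n\in\omega}$ of open sets in $X$ with $F=\bigcap_{n}W_n=\bigcap_{n}\overline{W_n}$. $X$ is strongly open-Reznichenko if for every point $x\in X$ and every decreasing sequence $(U_n)_{n\in\omega}$ of open sets in $X$ with $x\in\bigcap_{n}\overline{U_n}$ there is a sequence $(F_n)_{n\in\omega}$ of finite sets $F_n\subset U_n$ such that each neighborhood of $x$ intersects all but finitely many of the sets $F_n$. *)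

theory Defs
  imports "HOL-Analysis.Analysis"
begin

text \<open>
  A (separated) uniformity on an arbitrary set \<open>S\<close>, given by its system of entourages.
  The class \<open>uniform_space\<close> ties one uniformity to each type, whereas here
  uniformities on a carrier set have to be quantified over.
\<close>

definition separated_uniformity_on :: "'a set \<Rightarrow> ('a \<times> 'a) set set \<Rightarrow> bool" where
  "separated_uniformity_on S \<U> \<longleftrightarrow>
     \<U> \<noteq> {} \<and>
     (\<forall>U\<in>\<U>. Id_on S \<subseteq> U \<and> U \<subseteq> S \<times> S) \<and>
     (\<forall>U\<in>\<U>. \<forall>V. U \<subseteq> V \<and> V \<subseteq> S \<times> S \<longrightarrow> V \<in> \<U>) \<and>
     (\<forall>U\<in>\<U>. \<forall>V\<in>\<U>. U \<inter> V \<in> \<U>) \<and>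
     (\<forall>U\<in>\<U>. U\<inverse> \<in> \<U>) \<and>
     (\<forall>U\<in>\<U>. \<exists>V\<in>\<U>. V O V \<subseteq> U) \<and>
     \<Inter>\<U> = Id_on S"

definition topology_generated_by_uniformity :: "'a topology \<Rightarrow> ('a \<times> 'a) set set \<Rightarrow> bool" where
  "topology_generated_by_uniformity X \<U> \<longleftrightarrow>
     (\<forall>W. openin X W \<longleftrightarrow> W \<subseteq> topspace X \<and> (\<forall>x\<in>W. \<exists>U\<in>\<U>. U `` {x} \<subseteq> W))"

text \<open>The order on \<^typ>\<open>nat \<Rightarrow> nat\<close> below is the pointwise one.\<close>

definition has_G_base :: "('a \<times> 'a) set set \<Rightarrow> bool" where
  "has_G_base \<U> \<longleftrightarrow>
     (\<exists>B :: (nat \<Rightarrow> nat) \<Rightarrow> ('a \<times> 'a) set.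
        (\<forall>\<alpha>. B \<alpha> \<in> \<U>) \<and>
        (\<forall>U\<in>\<U>. \<exists>\<alpha>. B \<alpha> \<subseteq> U) \<and>
        (\<forall>\<alpha> \<beta>. \<alpha> \<le> \<beta> \<longrightarrow> B \<beta> \<subseteq> B \<alpha>))"

definition closed_Gdelta_bar :: "'a topology \<Rightarrow> bool" where
  "closed_Gdelta_bar X \<longleftrightarrow>
     (\<forall>F. closedin X F \<longrightarrow>
        (\<exists>W :: nat \<Rightarrow> 'a set. (\<forall>n. openin X (W n)) \<and>
           F = (\<Inter>n. W n) \<and> F = (\<Inter>n. X closure_of W n)))"

text \<open>Neighborhoods \<open>N\<close> of \<open>x\<close> need not be open: some open \<open>V\<close> satisfies \<open>x \<in> V \<subseteq> N\<close>.\<close>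

definition strongly_open_Reznichenko :: "'a topology \<Rightarrow> bool" where
  "strongly_open_Reznichenko X \<longleftrightarrow>
     (\<forall>x\<in>topspace X. \<forall>U :: nat \<Rightarrow> 'a set.
        (\<forall>n. openin X (U n)) \<and> decseq U \<and> x \<in> (\<Inter>n. X closure_of U n) \<longrightarrow>
        (\<exists>F :: nat \<Rightarrow> 'a set. (\<forall>n. finite (F n) \<and> F n \<subseteq> U n) \<and>
           (\<forall>N\<subseteq>topspace X. (\<exists>V. openin X V \<and> x \<in> V \<and> V \<subseteq> N) \<longrightarrow>
              finite {n. N \<inter> F n = {}})))"

end

theory Submission
  imports Defs
begin

text \<open>
  The substance is that the three conditions on \<open>X\<close> imply metrizability. Let \<open>B\<close> be a
  \<open>\<omega>\<^sup>\<omega>\<close>-indexed base of the uniformity. The idea is to replace the uncountably many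
  entourages \<open>B \<alpha>\<close> by countably many relations, the intersections \<open>core s\<close> of all \<open>B \<beta>\<close> with
  \<open>\<beta>\<close> extending a finite sequence \<open>s\<close>. Along the initial segments of one \<open>\<alpha>\<close> these relations
  grow and stay inside \<open>B \<alpha>\<close>. A diagonal argument shows that they eventually become large: if for
  every \<open>k\<close> finitely many points avoid the relation of \<open>\<alpha>\<close> restricted to \<open>k\<close>, then a single
  \<open>\<beta>\<close> above \<open>\<alpha>\<close> has an entourage \<open>B \<beta>\<close> avoiding all of these points (\<open>uniform_avoidance\<close>), since each
  coordinate of \<open>\<beta>\<close> has to dominate only finitely many values different from that of \<open>\<alpha>\<close>.

  The argument is used twice. Applied to the finite sets supplied by the strong open
  Reznichenko property, it shows that for some \<open>k\<close> the closure of the ball of such a relation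
  is a neighborhood of its center; hence \<open>X\<close> is first countable
  (\<open>countable_local_base\<close>). Applied to points converging to the center, it then
  shows that some relation contains \<open>V \<times> V\<close> for an open \<open>V\<close> around a given point
  (\<open>prefix_core_square\<close>). So the open sets with square inside \<open>core s\<close> cover an open
  set \<open>T s\<close>, every point lies in some \<open>T s\<close> with \<open>core s\<close> as small as wanted, and there are
  countably many \<open>s\<close>. The complement of \<open>T s\<close> is an intersection of open sets \<open>W\<close>, and also of
  their closures; adding one \<open>W\<close> to the open sets just described gives an open cover of the
  whole space whose star at a point outside the closure of \<open>W\<close> is governed by \<open>core s\<close> alone.
  These countably many covers form a strong development, and Moore's theorem
  (\<open>Moore_metrization\<close>) gives a metric.

  Moore's theorem is obtained by Frink's method: at each point the neighborhoods are thinned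
  out at a speed depending on that point so that the star condition becomes uniform, which
  produces a countable uniform base. The chain construction turns such a base into a metric.

  Conversely, in a metric space the entourages of radius \<open>1 / (\<alpha> 0 + 1)\<close> form the required base,
  balls of shrinking radii give the strong open Reznichenko property, and the open
  \<open>1 / (n + 1)\<close>-neighborhoods of a closed set have closures intersecting in that set.
\<close>

section \<open>Metrization by a sequence of relations\<close>

text \<open>
The weighted paths of the classical metrization lemma: a step inside \<open>E n\<close> costs \<open>1 / 2 ^ n\<close>, and
the distance of two points will be the infimum of the costs of the paths joining them. The
length is recorded because the key estimate is proved by induction on it.
\<close>

inductive chain :: "(nat \<Rightarrow> 'a rel) \<Rightarrow> nat \<Rightarrow> 'a \<Rightarrow> 'a \<Rightarrow> real \<Rightarrow> bool" for E where
  Nil: "chain E 0 x x 0"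
| Step: "(x, y) \<in> E n \<Longrightarrow> chain E l y z w \<Longrightarrow> chain E (Suc l) x z (1 / 2 ^ n + w)"

lemma chain_nonneg: "chain E l x y w \<Longrightarrow> 0 \<le> w"
  by (induction rule: chain.induct) auto

lemma chain_zero: "chain E l x y w \<Longrightarrow> w = 0 \<Longrightarrow> x = y"
proof (induction rule: chain.induct)
  case (Step x y n l z w)
  have "(0::real) < 1 / 2 ^ n" by simp
  with chain_nonneg[OF Step(2)] Step(4) show ?case by linarith
qed simp

lemma chain_single: "(x, y) \<in> E n \<Longrightarrow> chain E 1 x y (1 / 2 ^ n)"
  using chain.Step[of x y E n 0 y 0] chain.Nil[of E y] by simp

lemma chain_append:
  "chain E l x y w \<Longrightarrow> chain E m y z v \<Longrightarrow> chain E (l + m) x z (w + v)"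
proof (induction rule: chain.induct)
  case (Step x y n l z' w)
  then show ?case using chain.Step[of x y E n "l + m" z "w + v"] by (simp add: add.assoc)
qed simp

lemma chain_rev:
  assumes sym: "\<And>n. sym (E n)"
  shows "chain E l x y w \<Longrightarrow> chain E l y x w"
proof (induction rule: chain.induct)
  case (Step x y n l z w)
  then have "(y, x) \<in> E n" using sym by (meson symD)
  from chain_append[OF Step(3) chain_single[of y x E n, OF this]] show ?case
    by (simp add: add.commute)
qed (rule chain.Nil)

text \<open>
Cutting a path at the step by which its cost first exceeds \<open>t\<close>. With \<open>t\<close> half of the cost,
both remaining pieces cost at most half.
\<close>

lemma chain_split:
  "chain E l x z w \<Longrightarrow> 0 \<le> t \<Longrightarrow> t < w \<Longrightarrow>
    \<exists>a b n l1 l2 p q. chain E l1 x a p \<and> (a, b) \<in> E n \<and> chain E l2 b z q \<and>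
      l1 < l \<and> l2 < l \<and> p \<le> t \<and> t < p + 1 / 2 ^ n \<and> w = p + 1 / 2 ^ n + q"
proof (induction arbitrary: t rule: chain.induct)
  case (Nil x t)
  then show ?case by linarith
next
  case (Step x y n l z w)
  show ?case
  proof (cases "t < 1 / 2 ^ n")
    case True
    then show ?thesis using Step.hyps Step.prems chain.Nil[of E x]
      by (intro exI[of _ x] exI[of _ y] exI[of _ n] exI[of _ 0] exI[of _ l] exI[of _ 0] exI[of _ w]) simp
  next
    case False
    then have "0 \<le> t - 1 / 2 ^ n" "t - 1 / 2 ^ n < w" using Step.prems by auto
    from Step.IH[OF this] obtain a b m l1 l2 p q where
      *: "chain E l1 y a p" "(a, b) \<in> E m" "chain E l2 b z q" "l1 < l" "l2 < l"
        "p \<le> t - 1 / 2 ^ n" "t - 1 / 2 ^ n < p + 1 / 2 ^ m" "w = p + 1 / 2 ^ m + q"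
      by blast
    have "chain E (Suc l1) x a (1 / 2 ^ n + p)"
      by (rule chain.Step) (fact Step.hyps(1), fact *(1))
    with * show ?thesis
      by (intro exI[of _ a] exI[of _ b] exI[of _ m] exI[of _ "Suc l1"] exI[of _ l2]
          exI[of _ "1 / 2 ^ n + p"] exI[of _ q]) (simp, linarith?)
  qed
qed

text \<open>
A cheap path cannot lead far. Halving splits it into two shorter paths of cost below
\<open>1 / 2 ^ Suc k\<close>, related by induction at level \<open>Suc k\<close>, and one step that is itself cheap, hence in
\<open>E (Suc k)\<close>. The hypothesis on triple compositions is made for these three pieces.
\<close>

lemma chain_short_imp_related:
  assumes refl: "\<And>n x. x \<in> S \<Longrightarrow> (x, x) \<in> E n"
    and sub: "\<And>n. E n \<subseteq> S \<times> S"
    and triple: "\<And>n. E (Suc n) O E (Suc n) O E (Suc n) \<subseteq> E n"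
  shows "chain E l x y w \<Longrightarrow> w < 1 / 2 ^ k \<Longrightarrow> x \<in> S \<Longrightarrow> (x, y) \<in> E k"
proof (induction l arbitrary: x y w k rule: less_induct)
  case (less l)
  have "E (Suc n) \<subseteq> E n" for n
    using triple[of n] refl sub[of "Suc n"] by fast
  then have anti: "E n \<subseteq> E m" if "m \<le> n" for m n
    using lift_Suc_antimono_le[of E] that by blast
  show ?case
  proof (cases "w = 0")
    case True
    then show ?thesis using chain_zero[OF less.prems(1)] refl less.prems(3) by blast
  next
    case False
    then have "0 \<le> w / 2" "w / 2 < w" using chain_nonneg[OF less.prems(1)] by auto
    from chain_split[OF less.prems(1) this] obtain a b n l1 l2 p q where
      *: "chain E l1 x a p" "(a, b) \<in> E n" "chain E l2 b y q" "l1 < l" "l2 < l"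
        "p \<le> w / 2" "w / 2 < p + 1 / 2 ^ n" "w = p + 1 / 2 ^ n + q" by blast
    have half: "w / 2 < 1 / 2 ^ Suc k" using less.prems(2) by simp
    have xa: "(x, a) \<in> E (Suc k)"
      by (rule less.IH[OF *(4) *(1) _ less.prems(3)]) (use *(6) half in linarith)
    have by': "(b, y) \<in> E (Suc k)"
      by (rule less.IH[OF *(5) *(3)]) (use *(2,7,8) half sub[of n] in auto)
    have "0 \<le> p" "0 \<le> q" using chain_nonneg[OF *(1)] chain_nonneg[OF *(3)] by auto
    then have "(1::real) / 2 ^ n < 1 / 2 ^ k" using *(8) less.prems(2) by linarith
    then have "(2::real) ^ k < 2 ^ n" by (simp add: divide_simps)
    then have "Suc k \<le> n" by simp
    then have "(a, b) \<in> E (Suc k)" using anti *(2) by blast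
    with xa by' show ?thesis using triple[of k] by blast
  qed
qed

text \<open>
The path metric \<open>d\<close> is squeezed between the relations: \<open>d x y < 1 / 2 ^ k\<close> implies \<open>(x, y) \<in> E k\<close>,
which in turn implies \<open>d x y \<le> 1 / 2 ^ k\<close>. So \<open>d\<close> induces the topology described by the
relations. Starting from the full relation \<open>E 0\<close> makes any two points joinable, hence \<open>d\<close> finite.
\<close>

lemma metrizable_space_if_countable_uniform_base:
  assumes refl: "\<And>n x. x \<in> topspace X \<Longrightarrow> (x, x) \<in> E n"
    and sym: "\<And>n. sym (E n)"
    and zero: "E 0 = topspace X \<times> topspace X"
    and sub: "\<And>n. E n \<subseteq> topspace X \<times> topspace X"
    and triple: "\<And>n. E (Suc n) O E (Suc n) O E (Suc n) \<subseteq> E n"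
    and sep: "\<And>x y. (\<And>n. (x, y) \<in> E n) \<Longrightarrow> x = y"
    and top: "\<And>W. openin X W \<longleftrightarrow> W \<subseteq> topspace X \<and> (\<forall>x\<in>W. \<exists>n. E n `` {x} \<subseteq> W)"
  shows "metrizable_space X"
proof -
  define S where "S = topspace X"
  define C where "C x y = {w. \<exists>l. chain E l x y w}" for x y
  define d where "d x y = (if x \<in> S \<and> y \<in> S then Inf (C x y) else 0)" for x y
  note S = S_def[symmetric]
  have bdd: "bdd_below (C x y)" for x y
    unfolding C_def by (rule bdd_belowI[of _ 0]) (auto dest: chain_nonneg)
  have ne: "C x y \<noteq> {}" if "x \<in> S" "y \<in> S" for x y
    using chain_single[of x y E 0] that zero unfolding C_def S by blast
  have le: "d x y \<le> w" if "chain E l x y w" "x \<in> S" "y \<in> S" for x y w l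
    unfolding d_def using that bdd by (auto intro!: cInf_lower simp: C_def)
  have approx: "\<exists>l w. chain E l x y w \<and> w < r" if "d x y < r" "x \<in> S" "y \<in> S" for x y r
    using that cInf_lessD[OF ne[OF that(2,3)], of r] unfolding d_def C_def by auto
  have small: "(x, y) \<in> E k" if xy: "d x y < 1 / 2 ^ k" "x \<in> S" "y \<in> S" for x y k
  proof -
    obtain l w where "chain E l x y w" "w < 1 / 2 ^ k" using approx[OF xy] by blast
    then show ?thesis
      using chain_short_imp_related[where E = E and S = S] refl sub triple \<open>x \<in> S\<close>
      unfolding S by blast
  qed
  have nonneg: "0 \<le> d x y" for x y
    unfolding d_def using ne by (auto intro!: cInf_greatest simp: C_def dest: chain_nonneg)
  have "C x y = C y x" for x y
    unfolding C_def using chain_rev[where E = E, OF sym] by blast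
  then have comm: "d x y = d y x" for x y
    unfolding d_def by auto
  have near: "d x y \<le> 1 / 2 ^ n" if "(x, y) \<in> E n" for x y n
    using le[OF chain_single[of x y E n, OF that]] that sub[of n] unfolding S by auto
  interpret Metric_space S d
  proof
    fix x y z
    show "0 \<le> d x y" by (rule nonneg)
    show "d x y = d y x" by (rule comm)
    show "d x y = 0 \<longleftrightarrow> x = y" if xy: "x \<in> S" "y \<in> S"
    proof
      assume "d x y = 0"
      then show "x = y" using small[OF _ xy] by (intro sep) auto
    next
      assume "x = y"
      then show "d x y = 0"
        using le[OF chain.Nil[of E x]] xy nonneg[of x y] by auto
    qed
    show "d x z \<le> d x y + d y z" if xyz: "x \<in> S" "y \<in> S" "z \<in> S"
    proof (rule field_le_epsilon)
      fix e :: real assume "0 < e"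
      then obtain l w m v where c: "chain E l x y w" "w < d x y + e / 2"
        "chain E m y z v" "v < d y z + e / 2"
        using approx[of x y "d x y + e / 2"] approx[of y z "d y z + e / 2"] xyz by auto
      have "d x z \<le> w + v" using le[OF chain_append[OF c(1,3)]] xyz by blast
      with c show "d x z \<le> d x y + d y z + e" by linarith
    qed
  qed
  have "openin mtopology W \<longleftrightarrow> openin X W" for W
  proof -
    have "(\<exists>r>0. mball x r \<subseteq> W) \<longleftrightarrow> (\<exists>n. E n `` {x} \<subseteq> W)" if x: "x \<in> S" for x
    proof
      assume "\<exists>r>0. mball x r \<subseteq> W"
      then obtain r where r: "r > 0" "mball x r \<subseteq> W" by blast
      obtain n where n: "1 / 2 ^ n < r"
        using real_arch_pow_inv[OF r(1), of "1/2"] by (auto simp: power_one_over)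
      have "E n `` {x} \<subseteq> mball x r"
        using near n sub[of n] x unfolding S by (fastforce simp: in_mball)
      then show "\<exists>n. E n `` {x} \<subseteq> W" using r by blast
    next
      assume "\<exists>n. E n `` {x} \<subseteq> W"
      then obtain n where "E n `` {x} \<subseteq> W" by blast
      then have "mball x (1 / 2 ^ n) \<subseteq> W" using small by (auto simp: in_mball)
      then show "\<exists>r>0. mball x r \<subseteq> W" by (intro exI[of _ "1 / 2 ^ n"]) simp
    qed
    then show ?thesis unfolding openin_mtopology top[of W] S by blast
  qed
  then have "mtopology = X" by (simp add: topology_eq)
  then show ?thesis using metrizable_space_mtopology by metis
qed

section \<open>Metrization by a strong development\<close>

text \<open>
A sequence of open covers is given here by choosing, for each cover \<open>i\<close>, one member \<open>G i y\<close> around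
every point \<open>y\<close>; only these members enter the proof. The hypothesis \<open>star\<close> says that the
covers form a strong development.

Intersecting the first \<open>n\<close> chosen members gives neighborhoods \<open>V n x\<close> with Frink's property: for
all \<open>x\<close> and \<open>n\<close> there is \<open>m\<close> such that \<open>V m y \<subseteq> V n x\<close> whenever \<open>V m y\<close> meets \<open>V m x\<close>. Iterating
\<open>n \<mapsto> m\<close> separately at each point makes the dependence on \<open>x\<close> disappear.
\<close>

lemma Moore_metrization:
  fixes X :: "'a topology" and G :: "'i::countable \<Rightarrow> 'a \<Rightarrow> 'a set"
  assumes "t0_space X"
    and G: "\<And>i x. x \<in> topspace X \<Longrightarrow> openin X (G i x) \<and> x \<in> G i x"
    and star: "\<And>x N. openin X N \<Longrightarrow> x \<in> N \<Longrightarrow>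
      \<exists>i V. openin X V \<and> x \<in> V \<and> (\<forall>y\<in>topspace X. G i y \<inter> V \<noteq> {} \<longrightarrow> G i y \<subseteq> N)"
  shows "metrizable_space X"
proof -
  define S where "S = topspace X"
  note S = S_def[symmetric]
  define V where "V n x = S \<inter> (\<Inter>i<n. G (from_nat i) x)" for n x
  have openV: "openin X (V n x)" if "x \<in> S" for n x
  proof (induction n)
    case 0
    show ?case by (simp add: V_def S_def)
  next
    case (Suc n)
    have "V (Suc n) x = V n x \<inter> G (from_nat n) x"
      unfolding V_def by (auto simp: less_Suc_eq)
    then show ?case using Suc G that unfolding S by auto
  qed
  have inV: "x \<in> V n x" if "x \<in> S" for n x
    using that G unfolding V_def S by auto
  have VS: "V n x \<subseteq> S" for n x unfolding V_def by auto
  have V_anti: "V n x \<subseteq> V m x" if "m \<le> n" for m n x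
    using that unfolding V_def by auto
  have VG: "V n x \<subseteq> G i x" if "to_nat i < n" for n i x
  proof -
    have "V n x \<subseteq> G (from_nat (to_nat i)) x" using that unfolding V_def by blast
    then show ?thesis by simp
  qed
  have V_base: "\<exists>n. V n x \<subseteq> N" if N: "openin X N" "x \<in> N" for x N
  proof -
    have xS: "x \<in> S" using N openin_subset S_def by blast
    obtain i W where "x \<in> W" "\<And>y. y \<in> S \<Longrightarrow> G i y \<inter> W \<noteq> {} \<Longrightarrow> G i y \<subseteq> N"
      using star[OF N] unfolding S by blast
    then have "G i x \<subseteq> N" using xS G unfolding S by blast
    then show ?thesis using VG[of i "Suc (to_nat i)" x] by blast
  qed
  have V_star: "\<exists>m. n < m \<and> (\<forall>y\<in>S. V m x \<inter> V m y \<noteq> {} \<longrightarrow> V m y \<subseteq> V n x)"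
    if xS: "x \<in> S" for x n
  proof -
    obtain i W where W: "openin X W" "x \<in> W"
      "\<And>y. y \<in> S \<Longrightarrow> G i y \<inter> W \<noteq> {} \<Longrightarrow> G i y \<subseteq> V n x"
      using star[OF openV[OF xS, of n] inV[OF xS, of n]] unfolding S by blast
    obtain k where k: "V k x \<subseteq> W" using V_base[OF W(1,2)] by blast
    define m where "m = Suc (max n (max k (to_nat i)))"
    have "V m y \<subseteq> V n x" if "y \<in> S" "V m x \<inter> V m y \<noteq> {}" for y
    proof -
      have "k \<le> m" unfolding m_def by linarith
      then have "V m x \<subseteq> W" using k V_anti[of k m x] by blast
      moreover have "V m y \<subseteq> G i y" by (rule VG) (simp add: m_def)
      ultimately show ?thesis using W(3)[OF that(1)] that(2) by blast
    qed
    then show ?thesis by (intro exI[of _ m]) (auto simp: m_def)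
  qed
  then obtain m where m: "\<And>x n. x \<in> S \<Longrightarrow> n < m x n"
      "\<And>x n y. x \<in> S \<Longrightarrow> y \<in> S \<Longrightarrow> V (m x n) x \<inter> V (m x n) y \<noteq> {} \<Longrightarrow>
        V (m x n) y \<subseteq> V n x"
    by metis
  \<comment> \<open>With \<open>U k x\<close> the neighborhood of \<open>x\<close> after \<open>k\<close> thinnings, if \<open>U (Suc k) x\<close> meets
    \<open>U (Suc k) y\<close>, then the one with the larger \<open>r (Suc k)\<close> is contained in the \<open>U k\<close> of the other point.\<close>
  define r where "r k x = (m x ^^ k) 0" for k x
  define U where "U k x = V (r k x) x" for k x
  have r_ge: "k \<le> r k x" if "x \<in> S" for k x
  proof (induction k)
    case (Suc k)
    then show ?case using m(1)[OF that, of "r k x"] by (simp add: r_def)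
  qed simp
  have U_half: "U (Suc k) y \<subseteq> U k x"
    if "x \<in> S" "y \<in> S" "r (Suc k) x \<le> r (Suc k) y" "U (Suc k) x \<inter> U (Suc k) y \<noteq> {}" for x y k
  proof -
    have eq: "r (Suc k) x = m x (r k x)" by (simp add: r_def)
    have "U (Suc k) y \<subseteq> V (r (Suc k) x) y" unfolding U_def by (rule V_anti[OF that(3)])
    moreover from this have "V (r (Suc k) x) y \<subseteq> U k x"
      using m(2)[OF that(1,2), of "r k x"] that(4) unfolding U_def eq by blast
    ultimately show ?thesis by blast
  qed
  have U_anti: "U (Suc k) x \<subseteq> U k x" if "x \<in> S" for k x
    using U_half[OF that that] inV[OF that] unfolding U_def by blast
  \<comment> \<open>Points are related when they share a member of the cover by the sets \<open>U k a\<close>; relating \<open>x\<close>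
    directly to \<open>U k x\<close> would not survive composition, as the middle point may be the center.\<close>
  define E where "E k = {(x, y). \<exists>a\<in>S. x \<in> U k a \<and> y \<in> U k a}" for k
  have comp: "E (Suc k) O E (Suc k) \<subseteq> E k" for k
  proof clarify
    fix x y z assume "(x, y) \<in> E (Suc k)" "(y, z) \<in> E (Suc k)"
    then obtain a b where ab: "a \<in> S" "b \<in> S" "x \<in> U (Suc k) a" "y \<in> U (Suc k) a"
      "y \<in> U (Suc k) b" "z \<in> U (Suc k) b" unfolding E_def by blast
    consider "r (Suc k) a \<le> r (Suc k) b" | "r (Suc k) b \<le> r (Suc k) a" by linarith
    then show "(x, z) \<in> E k"
    proof cases
      case 1
      then have "U (Suc k) b \<subseteq> U k a" using U_half ab by blast
      then show ?thesis using ab U_anti[OF ab(1)] unfolding E_def by blast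
    next
      case 2
      then have "U (Suc k) a \<subseteq> U k b" using U_half ab by blast
      then show ?thesis using ab U_anti[OF ab(2)] unfolding E_def by blast
    qed
  qed
  have E_refl: "(x, x) \<in> E n" if "x \<in> S" for n x
    using that inV unfolding E_def U_def by auto
  have E_sub: "E n \<subseteq> S \<times> S" for n
    using VS unfolding E_def U_def by blast
  have E_sym: "(y, x) \<in> E n" if "(x, y) \<in> E n" for n x y
    using that unfolding E_def by blast
  have E_anti: "E (Suc n) \<subseteq> E n" for n
    using comp[of n] E_refl E_sub[of "Suc n"] by fast
  have E_base: "\<exists>n. E (2 * n) `` {x} \<subseteq> N" if N: "openin X N" "x \<in> N" for x N
  proof -
    have xS: "x \<in> S" using N openin_subset S_def by blast
    obtain n where n: "V n x \<subseteq> N" using V_base[OF N] by blast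
    define k where "k = m x n"
    have "y \<in> N" if xy: "(x, y) \<in> E (2 * k)" for y
    proof -
      obtain a where a: "a \<in> S" "x \<in> U (2 * k) a" "y \<in> U (2 * k) a"
        using xy unfolding E_def by blast
      have "U (2 * k) a \<subseteq> V k a"
        unfolding U_def using r_ge[OF a(1), of "2 * k"] by (intro V_anti) auto
      moreover from this have "V k a \<subseteq> V n x"
        using m(2)[OF xS a(1), of n] a(2) inV[OF xS] unfolding k_def by blast
      ultimately show ?thesis using a n by blast
    qed
    then show ?thesis by blast
  qed
  \<comment> \<open>Composing twice costs two levels, so every second relation satisfies the triple condition.\<close>
  show ?thesis
  proof (rule metrizable_space_if_countable_uniform_base[where E = "\<lambda>n. E (2 * n)"], unfold S)
    fix n x y W
    show "x \<in> S \<Longrightarrow> (x, x) \<in> E (2 * n)" by (rule E_refl)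
    show "sym (E (2 * n))" using E_sym by (auto intro: symI)
    show "E (2 * 0) = S \<times> S"
      unfolding E_def U_def r_def V_def by auto
    show "E (2 * n) \<subseteq> S \<times> S" by (rule E_sub)
    show "E (2 * Suc n) O E (2 * Suc n) O E (2 * Suc n) \<subseteq> E (2 * n)"
      using comp[of "2 * n"] comp[of "Suc (2 * n)"] E_anti[of "Suc (2 * n)"] by fastforce
    show "x = y" if xy: "\<And>n. (x, y) \<in> E (2 * n)"
    proof (rule ccontr)
      assume "x \<noteq> y"
      moreover have "x \<in> topspace X" "y \<in> topspace X" using xy[of 0] E_sub[of 0] unfolding S by auto
      ultimately obtain N where N: "openin X N" "x \<in> N \<longleftrightarrow> y \<notin> N"
        using \<open>t0_space X\<close> unfolding t0_space_def by blast
      then show False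
        using E_base[OF N(1), of x] E_base[OF N(1), of y] xy E_sym by blast
    qed
    show "openin X W \<longleftrightarrow> W \<subseteq> S \<and> (\<forall>x\<in>W. \<exists>n. E (2 * n) `` {x} \<subseteq> W)"
    proof
      assume "openin X W"
      then show "W \<subseteq> S \<and> (\<forall>x\<in>W. \<exists>n. E (2 * n) `` {x} \<subseteq> W)"
        using E_base openin_subset[of X W] unfolding S by (intro conjI ballI) assumption+
    next
      assume W: "W \<subseteq> S \<and> (\<forall>x\<in>W. \<exists>n. E (2 * n) `` {x} \<subseteq> W)"
      have "\<exists>N. openin X N \<and> x \<in> N \<and> N \<subseteq> W" if "x \<in> W" for x
      proof -
        from W that obtain n where n: "x \<in> S" "E (2 * n) `` {x} \<subseteq> W" by blast
        have "U (2 * n) x \<subseteq> E (2 * n) `` {x}"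
          using n(1) inV unfolding E_def U_def by blast
        moreover have "openin X (U (2 * n) x)" "x \<in> U (2 * n) x"
          unfolding U_def by (rule openV[OF n(1)], rule inV[OF n(1)])
        ultimately show ?thesis using n(2) by blast
      qed
      then show "openin X W" by (subst openin_subopen) blast
    qed
  qed
qed

section \<open>Local bases indexed by functions\<close>

text \<open>
What is needed of a \<open>G\<close>-base: \<open>square\<close> and \<open>small\<close> express that the relations \<open>B \<alpha>\<close> are
neighborhoods of the diagonal and that their two-step balls shrink to points.
\<close>

locale G_neighbornet =
  fixes X :: "'a topology" and B :: "(nat \<Rightarrow> nat) \<Rightarrow> 'a rel"
  assumes antimono: "\<alpha> \<le> \<beta> \<Longrightarrow> B \<beta> \<subseteq> B \<alpha>"
    and square: "x \<in> topspace X \<Longrightarrow> \<exists>N. openin X N \<and> x \<in> N \<and> N \<times> N \<subseteq> B \<alpha>"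
    and small: "openin X N \<Longrightarrow> x \<in> N \<Longrightarrow> \<exists>\<alpha>. (B \<alpha> O B \<alpha>) `` {x} \<subseteq> N"
begin

text \<open>
The relations \<open>core s\<close> are indexed by lists to make their countability visible; the arguments
below use them along the initial segments of a fixed function.
\<close>

definition core :: "nat list \<Rightarrow> 'a rel" where
  "core s = (\<Inter>\<beta>\<in>{\<beta>. map \<beta> [0..<length s] = s}. B \<beta>)"

abbreviation prefix_core :: "(nat \<Rightarrow> nat) \<Rightarrow> nat \<Rightarrow> 'a rel" where
  "prefix_core \<alpha> k \<equiv> core (map \<alpha> [0..<k])"

lemma prefix_core_eq: "prefix_core \<alpha> k = (\<Inter>\<beta>\<in>{\<beta>. \<forall>i<k. \<beta> i = \<alpha> i}. B \<beta>)"
proof -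
  have "map \<beta> [0..<k] = map \<alpha> [0..<k] \<longleftrightarrow> (\<forall>i<k. \<beta> i = \<alpha> i)" for \<beta> by auto
  then show ?thesis unfolding core_def by simp
qed

lemma prefix_core_subset: "prefix_core \<alpha> k \<subseteq> B \<alpha>"
  unfolding prefix_core_eq by blast

lemma prefix_core_mono: "k \<le> l \<Longrightarrow> prefix_core \<alpha> k \<subseteq> prefix_core \<alpha> l"
  unfolding prefix_core_eq by (rule INF_superset_mono) auto

text \<open>
The diagonal argument. Each point \<open>p\<close> of \<open>P k\<close> avoids some \<open>B \<gamma>\<close> with \<open>\<gamma>\<close> equal to \<open>\<alpha>\<close> below \<open>k\<close>. At
coordinate \<open>i\<close> only the finitely many \<open>\<gamma>\<close> belonging to \<open>P k\<close> with \<open>k \<le> i\<close> can differ from \<open>\<alpha>\<close>, so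
all these \<open>\<gamma>\<close> have a common upper bound \<open>\<beta>\<close>.
\<close>

lemma uniform_avoidance:
  assumes fin: "\<And>k. finite (P k)" and avoid: "\<And>k. P k \<inter> prefix_core \<alpha> k = {}"
  shows "\<exists>\<beta>. \<forall>k. P k \<inter> B \<beta> = {}"
proof -
  have "\<exists>\<gamma>. (\<forall>i<k. \<gamma> i = \<alpha> i) \<and> p \<notin> B \<gamma>" if "p \<in> P k" for k p
    using avoid[of k] that unfolding prefix_core_eq by blast
  then have "\<exists>g. \<forall>k p. p \<in> P k \<longrightarrow> (\<forall>i<k. g k p i = \<alpha> i) \<and> p \<notin> B (g k p)"
    by (intro choice allI) blast
  then obtain g where g: "\<And>k p i. p \<in> P k \<Longrightarrow> i < k \<Longrightarrow> g k p i = \<alpha> i"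
    "\<And>k p. p \<in> P k \<Longrightarrow> p \<notin> B (g k p)"
    by blast
  define \<beta> where "\<beta> i = \<alpha> i + (\<Sum>k\<le>i. \<Sum>p\<in>P k. g k p i)" for i
  have "g k p \<le> \<beta>" if p: "p \<in> P k" for k p
  proof (rule le_funI)
    fix i
    show "g k p i \<le> \<beta> i"
    proof (cases "i < k")
      case True
      then show ?thesis using g(1)[OF p] unfolding \<beta>_def by simp
    next
      case False
      have "g k p i \<le> (\<Sum>p\<in>P k. g k p i)"
        using member_le_sum[OF p, of "\<lambda>p. g k p i"] fin by simp
      also have "\<dots> \<le> (\<Sum>k\<le>i. \<Sum>p\<in>P k. g k p i)"
        using member_le_sum[of k "{..i}" "\<lambda>k. \<Sum>p\<in>P k. g k p i"] False by simp
      finally show ?thesis unfolding \<beta>_def by simp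
    qed
  qed
  then have "P k \<inter> B \<beta> = {}" for k
    using g(2) antimono by blast
  then show ?thesis by blast
qed

lemma closure_image_small:
  assumes "openin X N" "x \<in> N"
  shows "\<exists>\<alpha>. X closure_of (B \<alpha> `` {x}) \<subseteq> N"
proof -
  obtain \<alpha> where \<alpha>: "(B \<alpha> O B \<alpha>) `` {x} \<subseteq> N" using small[OF assms] by blast
  have "y \<in> N" if y: "y \<in> X closure_of (B \<alpha> `` {x})" for y
  proof -
    obtain V where "openin X V" "y \<in> V" "V \<times> V \<subseteq> B \<alpha>"
      using square[of y \<alpha>] y by (auto simp: in_closure_of)
    moreover from this y obtain z where "z \<in> V" "(x, z) \<in> B \<alpha>"
      by (auto simp: in_closure_of)
    ultimately show ?thesis using \<alpha> by blast
  qed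
  then show ?thesis by blast
qed

text \<open>
Otherwise \<open>x\<close> lies in the closure of each of the decreasing open complements \<open>U k\<close>. The
strong open Reznichenko property picks finite subsets \<open>F k\<close> that every neighborhood of \<open>x\<close>
almost always meets, whereas the diagonal argument yields a neighborhood meeting none.
The closures are there because the complement of the ball itself need not be open.
\<close>

lemma closure_prefix_core_neighborhood:
  assumes SR: "strongly_open_Reznichenko X" and x: "x \<in> topspace X"
  shows "\<exists>k. x \<in> X interior_of (X closure_of (prefix_core \<alpha> k `` {x}))"
proof (rule ccontr)
  assume neg: "\<nexists>k. x \<in> X interior_of (X closure_of (prefix_core \<alpha> k `` {x}))"
  define U where "U k = topspace X - X closure_of (prefix_core \<alpha> k `` {x})" for k
  have "openin X (U k)" for k unfolding U_def by auto
  moreover have "decseq U"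
  proof (rule decseq_SucI)
    fix k
    have "prefix_core \<alpha> k `` {x} \<subseteq> prefix_core \<alpha> (Suc k) `` {x}"
      using prefix_core_mono[of k "Suc k"] by (intro Image_mono) auto
    then show "U (Suc k) \<subseteq> U k" unfolding U_def using closure_of_mono by blast
  qed
  moreover have "x \<in> (\<Inter>k. X closure_of U k)"
    using neg x unfolding U_def closure_of_complement by blast
  ultimately have "(\<forall>n. openin X (U n)) \<and> decseq U \<and> x \<in> (\<Inter>k. X closure_of U k)"
    by blast
  from SR[unfolded strongly_open_Reznichenko_def, rule_format, OF x this]
  obtain F where F: "\<And>n. finite (F n) \<and> F n \<subseteq> U n"
    and meets: "\<And>N. N \<subseteq> topspace X \<Longrightarrow> \<exists>V. openin X V \<and> x \<in> V \<and> V \<subseteq> N \<Longrightarrow>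
      finite {n. N \<inter> F n = {}}"
    by blast
  have "F n \<inter> prefix_core \<alpha> n `` {x} = {}" for n
    using F[of n] closure_of_subset_Int[of X "prefix_core \<alpha> n `` {x}"] unfolding U_def by blast
  then have "Pair x ` F n \<inter> prefix_core \<alpha> n = {}" for n by blast
  then obtain \<beta> where \<beta>: "\<And>n. Pair x ` F n \<inter> B \<beta> = {}"
    using uniform_avoidance[of "\<lambda>n. Pair x ` F n" \<alpha>] F by blast
  obtain N where N: "openin X N" "x \<in> N" "N \<times> N \<subseteq> B \<beta>" using square[OF x] by blast
  then have "N \<inter> F n = {}" for n using \<beta>[of n] by blast
  then have "finite (UNIV :: nat set)" using meets[of N] N openin_subset[OF N(1)] by auto
  then show False by simp
qed

text \<open>
There are only countably many lists \<open>s\<close>, and for small \<open>B \<alpha>\<close> the closure of the ball of \<open>core s\<close> given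
by the previous lemma is small too.
\<close>

lemma countable_local_base:
  assumes SR: "strongly_open_Reznichenko X" and x: "x \<in> topspace X"
  shows "\<exists>D :: nat \<Rightarrow> 'a set. (\<forall>j. openin X (D j) \<and> x \<in> D j) \<and>
    (\<forall>N. openin X N \<and> x \<in> N \<longrightarrow> (\<exists>j. D j \<subseteq> N))"
proof -
  define I where "I s = X interior_of (X closure_of (core s `` {x}))" for s
  define D where "D j = (if x \<in> I (from_nat j) then I (from_nat j) else topspace X)" for j
  have "openin X (D j) \<and> x \<in> D j" for j
    unfolding D_def I_def using x by simp
  moreover have "\<exists>j. D j \<subseteq> N" if N: "openin X N" "x \<in> N" for N
  proof -
    obtain \<alpha> where \<alpha>: "X closure_of (B \<alpha> `` {x}) \<subseteq> N" using closure_image_small[OF N] by blast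
    obtain k where k: "x \<in> I (map \<alpha> [0..<k])"
      using closure_prefix_core_neighborhood[OF SR x] unfolding I_def by blast
    have "I (map \<alpha> [0..<k]) \<subseteq> X closure_of (prefix_core \<alpha> k `` {x})"
      unfolding I_def by (rule interior_of_subset)
    also have "\<dots> \<subseteq> X closure_of (B \<alpha> `` {x})"
      using prefix_core_subset by (intro closure_of_mono Image_mono) auto
    finally have "D (to_nat (map \<alpha> [0..<k])) \<subseteq> N" using \<alpha> k unfolding D_def by simp
    then show ?thesis by blast
  qed
  ultimately show ?thesis by blast
qed

text \<open>
First countability replaces closures by convergence: if all relations along \<open>\<alpha>\<close> failed, there
would be pairs \<open>p k\<close> outside them converging to \<open>(x, x)\<close>, and the diagonal argument would
separate all these pairs from a neighborhood of \<open>(x, x)\<close>.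
\<close>

lemma prefix_core_square:
  assumes SR: "strongly_open_Reznichenko X" and x: "x \<in> topspace X"
  shows "\<exists>k V. openin X V \<and> x \<in> V \<and> V \<times> V \<subseteq> prefix_core \<alpha> k"
proof (rule ccontr)
  assume neg: "\<nexists>k V. openin X V \<and> x \<in> V \<and> V \<times> V \<subseteq> prefix_core \<alpha> k"
  obtain D :: "nat \<Rightarrow> 'a set" where D: "\<And>j. openin X (D j) \<and> x \<in> D j"
    "\<And>N. openin X N \<Longrightarrow> x \<in> N \<Longrightarrow> \<exists>j. D j \<subseteq> N"
    using countable_local_base[OF SR x] by blast
  define C where "C k = (\<Inter>j\<le>k. D j)" for k
  have "openin X (C k)" "x \<in> C k" for k
    unfolding C_def using D(1) by (auto intro!: openin_INT2)
  then have "\<exists>p. p \<in> C k \<times> C k \<and> p \<notin> prefix_core \<alpha> k" for k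
    using neg by (meson subsetI)
  then obtain p where p: "\<And>k. p k \<in> C k \<times> C k" "\<And>k. p k \<notin> prefix_core \<alpha> k"
    by metis
  obtain \<beta> where \<beta>: "\<And>k. p k \<notin> B \<beta>"
    using uniform_avoidance[of "\<lambda>k. {p k}" \<alpha>] p(2) by auto
  obtain N where N: "openin X N" "x \<in> N" "N \<times> N \<subseteq> B \<beta>" using square[OF x] by blast
  obtain j where "D j \<subseteq> N" using D(2) N by blast
  then have "C j \<subseteq> N" unfolding C_def by blast
  then have "C j \<times> C j \<subseteq> N \<times> N" by (intro Sigma_mono)
  then have "p j \<in> B \<beta>" using p(1)[of j] N(3) by (meson subsetD)
  then show False using \<beta> by blast
qed

text \<open>
The covers of the strong development are indexed by \<open>(s, n)\<close>: a point of \<open>T s\<close> gets an open set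
whose square lies in \<open>core s\<close>, any other point gets the \<open>n\<close>-th open set \<open>W s n\<close> around the
complement of \<open>T s\<close>. Since the closures of the \<open>W s n\<close> also intersect in this complement, a point of
\<open>T s\<close> has, for some \<open>n\<close>, a neighborhood that \<open>W s n\<close> does not meet.
\<close>

lemma metrizable:
  assumes "t0_space X" and SR: "strongly_open_Reznichenko X" and GD: "closed_Gdelta_bar X"
  shows "metrizable_space X"
proof -
  define T where "T s = \<Union> {V. openin X V \<and> V \<times> V \<subseteq> core s}" for s
  have "closedin X (topspace X - T s)" for s
    unfolding T_def by (rule closedin_diff[OF closedin_topspace], rule openin_Union) blast
  then have "\<exists>W :: nat \<Rightarrow> 'a set. (\<forall>n. openin X (W n)) \<and>
      topspace X - T s = (\<Inter>n. W n) \<and> topspace X - T s = (\<Inter>n. X closure_of W n)" for s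
    using GD unfolding closed_Gdelta_bar_def by blast
  then obtain W :: "nat list \<Rightarrow> nat \<Rightarrow> 'a set" where openW: "\<And>s n. openin X (W s n)"
    and W: "\<And>s. topspace X - T s = (\<Inter>n. W s n)"
    and clW: "\<And>s. topspace X - T s = (\<Inter>n. X closure_of W s n)"
    by metis
  define V where "V s y = (SOME V. openin X V \<and> y \<in> V \<and> V \<times> V \<subseteq> core s)" for s y
  have V: "openin X (V s y) \<and> y \<in> V s y \<and> V s y \<times> V s y \<subseteq> core s" if "y \<in> T s" for s y
    unfolding V_def by (rule someI_ex) (use that in \<open>auto simp: T_def\<close>)
  define G where "G i y = (case i of (s, n) \<Rightarrow> if y \<in> T s then V s y else W s n)" for i y
  show ?thesis
  proof (rule Moore_metrization[OF \<open>t0_space X\<close>, of G])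
    fix i :: "nat list \<times> nat" and x assume x: "x \<in> topspace X"
    obtain s n where i: "i = (s, n)" by (cases i)
    show "openin X (G i x) \<and> x \<in> G i x"
    proof (cases "x \<in> T s")
      case True
      then show ?thesis using V[OF True] by (simp add: G_def i)
    next
      case False
      then have "x \<in> W s n" using W[of s] x by blast
      then show ?thesis using False openW by (simp add: G_def i)
    qed
  next
    fix x N assume N: "openin X N" "x \<in> N"
    then have x: "x \<in> topspace X" using openin_subset[OF N(1)] by blast
    obtain \<alpha> where \<alpha>: "(B \<alpha> O B \<alpha>) `` {x} \<subseteq> N" using small[OF N] by blast
    obtain k O\<^sub>x where O\<^sub>x: "openin X O\<^sub>x" "x \<in> O\<^sub>x" "O\<^sub>x \<times> O\<^sub>x \<subseteq> prefix_core \<alpha> k"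
      using prefix_core_square[OF SR x] by blast
    define s where "s = map \<alpha> [0..<k]"
    have core: "core s \<subseteq> B \<alpha>" unfolding s_def by (rule prefix_core_subset)
    have "x \<in> T s" using O\<^sub>x unfolding T_def s_def by blast
    then obtain n where n: "x \<notin> X closure_of W s n" using clW[of s] by blast
    define O' where "O' = O\<^sub>x \<inter> (topspace X - X closure_of W s n)"
    have O': "openin X O'" "x \<in> O'" using O\<^sub>x n x unfolding O'_def
      by (auto intro!: openin_Int openin_diff)
    have "G (s, n) y \<subseteq> N" if meet: "G (s, n) y \<inter> O' \<noteq> {}" for y
    proof -
      obtain z where z: "z \<in> G (s, n) y" "z \<in> O'" using meet by blast
      have "z \<notin> W s n"
        using z(2) closure_of_subset[OF openin_subset[OF openW]] unfolding O'_def by blast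
      then have "y \<in> T s" using z(1) unfolding G_def by (auto split: if_splits)
      then have "G (s, n) y \<times> G (s, n) y \<subseteq> B \<alpha>" using V core unfolding G_def by auto
      moreover have "(x, z) \<in> B \<alpha>"
        using z(2) O\<^sub>x core unfolding O'_def s_def by blast
      ultimately show ?thesis using z(1) \<alpha> by blast
    qed
    then show "\<exists>i V. openin X V \<and> x \<in> V \<and>
        (\<forall>y\<in>topspace X. G i y \<inter> V \<noteq> {} \<longrightarrow> G i y \<subseteq> N)"
      using O' by (intro exI[of _ "(s, n)"] exI[of _ O'] conjI ballI impI)
  qed
qed

end

section \<open>Uniformities with a base indexed by functions\<close>

lemma separated_uniformity_onD:
  assumes "separated_uniformity_on S \<U>"
  shows "U \<in> \<U> \<Longrightarrow> x \<in> S \<Longrightarrow> (x, x) \<in> U"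
    and "U \<in> \<U> \<Longrightarrow> U \<subseteq> S \<times> S"
    and "U \<in> \<U> \<Longrightarrow> V \<in> \<U> \<Longrightarrow> U \<inter> V \<in> \<U>"
    and "U \<in> \<U> \<Longrightarrow> U\<inverse> \<in> \<U>"
    and "U \<in> \<U> \<Longrightarrow> \<exists>V\<in>\<U>. V O V \<subseteq> U"
    and "\<Inter>\<U> = Id_on S"
proof -
  note conjuncts = assms[unfolded separated_uniformity_on_def]
  have "\<forall>U\<in>\<U>. Id_on S \<subseteq> U \<and> U \<subseteq> S \<times> S" using conjuncts by (elim conjE)
  then show "U \<in> \<U> \<Longrightarrow> x \<in> S \<Longrightarrow> (x, x) \<in> U" "U \<in> \<U> \<Longrightarrow> U \<subseteq> S \<times> S" by blast+
  have "\<forall>U\<in>\<U>. \<forall>V\<in>\<U>. U \<inter> V \<in> \<U>" using conjuncts by (elim conjE)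
  then show "U \<in> \<U> \<Longrightarrow> V \<in> \<U> \<Longrightarrow> U \<inter> V \<in> \<U>" by simp
  have "\<forall>U\<in>\<U>. U\<inverse> \<in> \<U>" using conjuncts by (elim conjE)
  then show "U \<in> \<U> \<Longrightarrow> U\<inverse> \<in> \<U>" by simp
  have "\<forall>U\<in>\<U>. \<exists>V\<in>\<U>. V O V \<subseteq> U" using conjuncts by (elim conjE)
  then show "U \<in> \<U> \<Longrightarrow> \<exists>V\<in>\<U>. V O V \<subseteq> U" by simp
  show "\<Inter>\<U> = Id_on S" using conjuncts by (elim conjE)
qed

text \<open>
The generated topology declares a set open when it contains a ball around each of its points;
that a ball is a neighborhood of its center is a consequence of the halving axiom. The open
set \<open>N\<close> is the interior of the ball at \<open>x\<close> of a symmetric entourage whose square is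
contained in \<open>U\<close>.
\<close>

lemma entourage_contains_open_square:
  assumes unif: "separated_uniformity_on (topspace X) \<U>"
    and gen: "topology_generated_by_uniformity X \<U>"
    and U: "U \<in> \<U>" and x: "x \<in> topspace X"
  shows "\<exists>N. openin X N \<and> x \<in> N \<and> N \<times> N \<subseteq> U"
proof -
  note refl = separated_uniformity_onD(1)[OF unif]
    and sub = separated_uniformity_onD(2)[OF unif]
    and half = separated_uniformity_onD(5)[OF unif]
  obtain V where V: "V \<in> \<U>" "V O V \<subseteq> U" using half[OF U] by blast
  define V' where "V' = V \<inter> V\<inverse>"
  have V': "V' \<in> \<U>"
    unfolding V'_def using V(1) by (intro separated_uniformity_onD(3,4)[OF unif])
  define N where "N = {y \<in> topspace X. \<exists>W\<in>\<U>. W `` {y} \<subseteq> V' `` {x}}"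
  have "\<exists>W\<in>\<U>. W `` {y} \<subseteq> N" if y: "y \<in> N" for y
  proof -
    obtain A where A: "A \<in> \<U>" "A `` {y} \<subseteq> V' `` {x}" using y unfolding N_def by blast
    obtain W where W: "W \<in> \<U>" "W O W \<subseteq> A" using half[OF A(1)] by blast
    have "W `` {y} \<subseteq> topspace X" using sub[OF W(1)] by blast
    moreover have "W `` {z} \<subseteq> V' `` {x}" if "(y, z) \<in> W" for z
      using that W A by blast
    ultimately have "W `` {y} \<subseteq> N" using W(1) unfolding N_def by blast
    then show ?thesis using W(1) by blast
  qed
  then have "openin X N"
    using gen unfolding topology_generated_by_uniformity_def N_def by auto
  moreover have "x \<in> N" using x V' unfolding N_def by blast
  moreover have "N \<subseteq> V' `` {x}" using refl unfolding N_def by blast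
  then have "N \<times> N \<subseteq> U" using V(2) unfolding V'_def by blast
  ultimately show ?thesis by blast
qed

lemma metrizable_space_if_G_base:
  assumes unif: "separated_uniformity_on (topspace X) \<U>"
    and gen: "topology_generated_by_uniformity X \<U>" and "has_G_base \<U>"
    and SR: "strongly_open_Reznichenko X" and GD: "closed_Gdelta_bar X"
  shows "metrizable_space X"
proof -
  obtain B :: "(nat \<Rightarrow> nat) \<Rightarrow> 'a rel" where "\<forall>\<alpha>. B \<alpha> \<in> \<U>"
    "\<forall>U\<in>\<U>. \<exists>\<alpha>. B \<alpha> \<subseteq> U" "\<forall>\<alpha> \<beta>. \<alpha> \<le> \<beta> \<longrightarrow> B \<beta> \<subseteq> B \<alpha>"
    using \<open>has_G_base \<U>\<close> unfolding has_G_base_def by (elim exE conjE) (rule that)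
  then have B: "\<And>\<alpha>. B \<alpha> \<in> \<U>" "\<And>U. U \<in> \<U> \<Longrightarrow> \<exists>\<alpha>. B \<alpha> \<subseteq> U"
    "\<And>\<alpha> \<beta>. \<alpha> \<le> \<beta> \<Longrightarrow> B \<beta> \<subseteq> B \<alpha>"
    by simp_all
  interpret G_neighbornet X B
  proof
    fix N x assume "openin X N" "x \<in> N"
    then obtain U where U: "U \<in> \<U>" "U `` {x} \<subseteq> N"
      using gen unfolding topology_generated_by_uniformity_def by blast
    then obtain V where "V \<in> \<U>" "V O V \<subseteq> U"
      using separated_uniformity_onD(5)[OF unif] by blast
    moreover from this obtain \<alpha> where "B \<alpha> \<subseteq> V" using B(2) by blast
    ultimately have "(B \<alpha> O B \<alpha>) `` {x} \<subseteq> N" using U(2) by blast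
    then show "\<exists>\<alpha>. (B \<alpha> O B \<alpha>) `` {x} \<subseteq> N" by blast
  qed (fact B(3), fact entourage_contains_open_square[OF unif gen B(1)])
  have "t0_space X"
    unfolding t0_space_def
  proof (intro ballI impI)
    fix x y assume xy: "x \<in> topspace X" "y \<in> topspace X" "x \<noteq> y"
    then have "(x, y) \<notin> \<Inter>\<U>" unfolding separated_uniformity_onD(6)[OF unif] by auto
    then obtain U where U: "U \<in> \<U>" "(x, y) \<notin> U" by blast
    obtain N where "openin X N" "x \<in> N" "N \<times> N \<subseteq> U"
      using entourage_contains_open_square[OF unif gen U(1) xy(1)] by blast
    with U(2) show "\<exists>N. openin X N \<and> (x \<notin> N \<longleftrightarrow> y \<in> N)" by blast
  qed
  then show ?thesis by (rule metrizable[OF _ SR GD])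
qed

section \<open>Metric spaces\<close>

context Metric_space
begin

lemma strongly_open_Reznichenko_mtopology: "strongly_open_Reznichenko mtopology"
  unfolding strongly_open_Reznichenko_def
proof (intro ballI allI impI)
  fix x and U :: "nat \<Rightarrow> 'a set"
  assume x: "x \<in> topspace mtopology"
    and U: "(\<forall>n. openin mtopology (U n)) \<and> decseq U \<and> x \<in> (\<Inter>n. mtopology closure_of U n)"
  \<comment> \<open>Singletons suffice: points of the open sets converging to \<open>x\<close>.\<close>
  have "\<exists>y\<in>U n. y \<in> mball x (1 / Suc n)" for n
  proof -
    have "x \<in> mtopology closure_of U n" using U by blast
    then show ?thesis unfolding metric_closure_of by auto
  qed
  then obtain y where y: "\<And>n. y n \<in> U n" "\<And>n. y n \<in> mball x (1 / Suc n)" by metis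
  have "finite {n. N \<inter> {y n} = {}}" if N: "\<exists>V. openin mtopology V \<and> x \<in> V \<and> V \<subseteq> N" for N
  proof -
    obtain r where r: "r > 0" "mball x r \<subseteq> N"
      using N unfolding openin_mtopology by (meson subset_trans)
    obtain m where m: "1 / Suc m < r" using nat_approx_posE[OF r(1)] by blast
    have "y n \<in> N" if "m \<le> n" for n
    proof -
      have "1 / Suc n \<le> 1 / Suc m" using that by (simp add: frac_le)
      then have "1 / Suc n \<le> r" using m by linarith
      then show ?thesis using y(2)[of n] r(2) mball_subset_concentric[of "1 / Suc n" r x] by blast
    qed
    then have "{n. N \<inter> {y n} = {}} \<subseteq> {..<m}" by (auto simp: not_less[symmetric])
    then show ?thesis using finite_subset by blast
  qed
  then show "\<exists>F. (\<forall>n. finite (F n) \<and> F n \<subseteq> U n) \<and>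
      (\<forall>N\<subseteq>topspace mtopology. (\<exists>V. openin mtopology V \<and> x \<in> V \<and> V \<subseteq> N) \<longrightarrow>
        finite {n. N \<inter> F n = {}})"
    using y(1) by (intro exI[of _ "\<lambda>n. {y n}"]) auto
qed

text \<open>
A closed set is the intersection of its \<open>1 / (n + 1)\<close>-neighborhoods, and a point in the closure of
such a neighborhood is within twice that distance of the set.
\<close>

lemma closed_Gdelta_bar_mtopology: "closed_Gdelta_bar mtopology"
  unfolding closed_Gdelta_bar_def
proof (intro allI impI)
  fix F assume F: "closedin mtopology F"
  define W where "W n = (\<Union>a\<in>F. mball a (1 / Suc n))" for n
  have FM: "F \<subseteq> M" using closedin_subset[OF F] by simp
  have openW: "openin mtopology (W n)" for n unfolding W_def by auto
  have FW: "F \<subseteq> W n" for n using FM unfolding W_def by fastforce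
  have Wcl: "W n \<subseteq> mtopology closure_of W n" for n
    by (rule closure_of_subset[OF openin_subset[OF openW]])
  have "x \<in> F" if x: "\<And>n. x \<in> mtopology closure_of W n" for x
  proof -
    have xM: "x \<in> M" using x[of 0] by (simp add: metric_closure_of)
    have "\<exists>a\<in>F. a \<in> mball x r" if r: "r > 0" for r
    proof -
      have r2: "r / 2 > 0" using r by simp
      obtain n where n: "1 / Suc n < r / 2" using nat_approx_posE[OF r2] by blast
      have "\<exists>y\<in>W n. y \<in> mball x (r / 2)"
        using x[of n] r2 unfolding metric_closure_of by blast
      then obtain y a where ya: "y \<in> mball x (r / 2)" "a \<in> F" "y \<in> mball a (1 / Suc n)"
        unfolding W_def by blast
      then have "d x y < r / 2" "d y a < r / 2" "y \<in> M" "a \<in> M"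
        using n commute[of a y] by auto
      then have "a \<in> mball x r" using triangle[of x y a] xM by auto
      then show ?thesis using ya(2) by blast
    qed
    then have "x \<in> mtopology closure_of F" using xM unfolding metric_closure_of by blast
    then show ?thesis using closure_of_closedin[OF F] by simp
  qed
  then have 1: "(\<Inter>n. mtopology closure_of W n) \<subseteq> F" by blast
  have 2: "F \<subseteq> (\<Inter>n. W n)" using FW by blast
  have 3: "(\<Inter>n. W n) \<subseteq> (\<Inter>n. mtopology closure_of W n)" using Wcl by blast
  have "F = (\<Inter>n. W n)" by (rule subset_antisym[OF 2 order_trans[OF 3 1]])
  moreover have "F = (\<Inter>n. mtopology closure_of W n)"
    by (rule subset_antisym[OF order_trans[OF 2 3] 1])
  ultimately show "\<exists>W :: nat \<Rightarrow> 'a set. (\<forall>n. openin mtopology (W n)) \<and>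
      F = (\<Inter>n. W n) \<and> F = (\<Inter>n. mtopology closure_of W n)"
    using openW by (intro exI[of _ W] conjI allI)
qed

definition near :: "real \<Rightarrow> 'a rel" where
  "near e = {(x, y). x \<in> M \<and> y \<in> M \<and> d x y < e}"

definition metric_uniformity :: "'a rel set" where
  "metric_uniformity = {U. U \<subseteq> M \<times> M \<and> (\<exists>e>0. near e \<subseteq> U)}"

lemma near_in_metric_uniformity: "e > 0 \<Longrightarrow> near e \<in> metric_uniformity"
  unfolding metric_uniformity_def near_def by auto

lemma near_Image: "x \<in> M \<Longrightarrow> near e `` {x} = mball x e"
  unfolding near_def by (auto simp: in_mball)

lemma near_mono: "e \<le> f \<Longrightarrow> near e \<subseteq> near f"
  unfolding near_def by auto

lemma separated_metric_uniformity: "separated_uniformity_on M metric_uniformity"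
  unfolding separated_uniformity_on_def
proof (intro conjI ballI allI impI)
  show "metric_uniformity \<noteq> {}" using near_in_metric_uniformity[of 1] by auto
  show "\<Inter> metric_uniformity = Id_on M"
  proof
    show "\<Inter> metric_uniformity \<subseteq> Id_on M"
    proof clarify
      fix x y assume xy: "(x, y) \<in> \<Inter> metric_uniformity"
      then have near: "(x, y) \<in> near e" if "e > 0" for e
        using near_in_metric_uniformity[OF that] by blast
      then have M: "x \<in> M" "y \<in> M" using near[of 1] by (auto simp: near_def)
      have "d x y \<le> 0"
        by (rule field_le_epsilon) (use near in \<open>force simp: near_def\<close>)
      then have "x = y" using M zero[of x y] nonneg[of x y] by auto
      then show "(x, y) \<in> Id_on M" using M by auto
    qed
  qed (auto simp: metric_uniformity_def near_def)
next
  fix U V assume "U \<in> metric_uniformity" "V \<in> metric_uniformity"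
  then obtain e f where ef: "e > 0" "f > 0" "near e \<subseteq> U" "near f \<subseteq> V"
    and sub: "U \<subseteq> M \<times> M"
    unfolding metric_uniformity_def by blast
  have "near (min e f) \<subseteq> U \<inter> V" using ef near_mono[of "min e f" e] near_mono[of "min e f" f] by auto
  moreover have "min e f > 0" using ef by simp
  ultimately show "U \<inter> V \<in> metric_uniformity" using sub unfolding metric_uniformity_def by blast
next
  fix U assume "U \<in> metric_uniformity"
  then obtain e where e: "e > 0" "near e \<subseteq> U" unfolding metric_uniformity_def by blast
  have "near (e / 2) O near (e / 2) \<subseteq> near e"
    unfolding near_def using triangle by fastforce
  then show "\<exists>V\<in>metric_uniformity. V O V \<subseteq> U"
    using e near_in_metric_uniformity[of "e / 2"] by (intro bexI[of _ "near (e / 2)"]) auto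
next
  fix U assume "U \<in> metric_uniformity"
  then obtain e where e: "e > 0" "near e \<subseteq> U" "U \<subseteq> M \<times> M"
    unfolding metric_uniformity_def by blast
  then show "U \<subseteq> M \<times> M" by blast
  show "Id_on M \<subseteq> U" using e(1,2) by (auto simp: near_def)
  have "near e \<subseteq> U\<inverse>" using e(2) by (auto simp: near_def commute)
  then show "U\<inverse> \<in> metric_uniformity" using e unfolding metric_uniformity_def by blast
  fix V assume "U \<subseteq> V \<and> V \<subseteq> M \<times> M"
  then show "V \<in> metric_uniformity" using e unfolding metric_uniformity_def by blast
qed

lemma mtopology_generated_by_metric_uniformity:
  "topology_generated_by_uniformity mtopology metric_uniformity"
proof -
  have "(\<exists>r>0. mball x r \<subseteq> W) \<longleftrightarrow> (\<exists>U\<in>metric_uniformity. U `` {x} \<subseteq> W)"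
    if x: "x \<in> M" for x W
  proof
    assume "\<exists>r>0. mball x r \<subseteq> W"
    then show "\<exists>U\<in>metric_uniformity. U `` {x} \<subseteq> W"
      using near_in_metric_uniformity near_Image[OF x] by metis
  next
    assume "\<exists>U\<in>metric_uniformity. U `` {x} \<subseteq> W"
    then obtain U e where "U `` {x} \<subseteq> W" "e > 0" "near e \<subseteq> U"
      unfolding metric_uniformity_def by blast
    then show "\<exists>r>0. mball x r \<subseteq> W"
      using near_Image[OF x, of e] by (intro exI[of _ e]) blast
  qed
  then show ?thesis
    unfolding topology_generated_by_uniformity_def openin_mtopology topspace_mtopology by blast
qed

text \<open>
A countable decreasing base becomes a base indexed by functions when only the value at \<open>0\<close> is
read.
\<close>

lemma has_G_base_metric_uniformity: "has_G_base metric_uniformity"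
  unfolding has_G_base_def
proof (intro exI[of _ "\<lambda>\<alpha>. near (1 / Suc (\<alpha> 0))"] conjI allI ballI impI)
  fix U assume "U \<in> metric_uniformity"
  then obtain e where e: "e > 0" "near e \<subseteq> U" unfolding metric_uniformity_def by blast
  obtain n where "1 / Suc n < e" using nat_approx_posE[OF e(1)] by blast
  then have "near (1 / Suc n) \<subseteq> U" using near_mono[of "1 / Suc n" e] e(2) by auto
  then show "\<exists>\<alpha>. near (1 / Suc (\<alpha> 0)) \<subseteq> U" by (intro exI[of _ "\<lambda>_. n"])
next
  fix \<alpha> \<beta> :: "nat \<Rightarrow> nat" assume "\<alpha> \<le> \<beta>"
  then show "near (1 / Suc (\<beta> 0)) \<subseteq> near (1 / Suc (\<alpha> 0))"
    by (intro near_mono frac_le) (auto dest: le_funD)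
qed (auto intro: near_in_metric_uniformity)

end

section \<open>The characterization of metrizability\<close>

theorem theorem6p4:
  fixes X :: "'a topology"
  shows "metrizable_space X \<longleftrightarrow>
    strongly_open_Reznichenko X \<and>
    closed_Gdelta_bar X \<and>
    (\<exists>\<U>. separated_uniformity_on (topspace X) \<U> \<and>
         topology_generated_by_uniformity X \<U> \<and>
         has_G_base \<U>)"
proof
  assume "metrizable_space X"
  then obtain M d where "Metric_space M d" and X: "X = Metric_space.mtopology M d"
    unfolding metrizable_space_def by blast
  then interpret Metric_space M d by blast
  show "strongly_open_Reznichenko X \<and> closed_Gdelta_bar X \<and>
      (\<exists>\<U>. separated_uniformity_on (topspace X) \<U> \<and>
        topology_generated_by_uniformity X \<U> \<and> has_G_base \<U>)"
    unfolding X topspace_mtopology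
    using strongly_open_Reznichenko_mtopology closed_Gdelta_bar_mtopology
      separated_metric_uniformity mtopology_generated_by_metric_uniformity
      has_G_base_metric_uniformity by blast
next
  assume "strongly_open_Reznichenko X \<and> closed_Gdelta_bar X \<and>
      (\<exists>\<U>. separated_uniformity_on (topspace X) \<U> \<and>
        topology_generated_by_uniformity X \<U> \<and> has_G_base \<U>)"
  then show "metrizable_space X" using metrizable_space_if_G_base by blast
qed

end
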